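(* Let $\Bbbk$ be a field and let $H=\Bbbk[T]$ be the coordinate Hopf algebra of the affine line $G=\mathbb A_1$. Every Leibniz algebra $L$ over $\Bbbk$ has a faithful conformal representation, i.e. there exist a left $H$-module $M$ and an injective homomorphism of Leibniz algebras $\rho: L\to \mathrm{gc}\, M^{(0)}$. Moreover, every finite-dimensional Leibniz algebra over $\Bbbk$ has a finite faithful conformal representation, i.e. one for which the $H$-module $M$ is finitely generated.
   Context: A (left) Leibniz algebra is a linear space with a bilinear operation $[\cdot\,\cdot]$ satisfying $[x_1[x_2x_3]]=[[x_1x_2]x_3]+[x_2[x_1x_3]]$. (Leibniz algebras are the same as Lie dialgebras, via $x\vdash y=[xy]$, $x\dashv y=-[yx]$.) $H=\Bbbk[T]$ has the Hopf algebra structure $\Delta(T)=T\otimes1+1\otimes T$, $\varepsilon(h)=h(0)$, $S(h)=h(-T)$, with Sweedler notation $\Delta(h)=h_{(1)}\otimes h_{(2)}$. $H^{\otimes 2}=H\otimes H$ is a right $H$-module via $(f\otimes g)h=fh_{(1)}\otimes gh_{(2)}$. If $\{h_i\}$ is a $\Bbbk$-basis of $H$, then $\{h_i\otimes 1\}$ is a basis of $H\otimes H$ as a free right $H$-module, so every element of $H^{\otimes2}\otimes_H M$ (for a left $H$-module $M$) is uniquely a finite sum $\sum_i h_i\otimes1\otimes_H w_i$, $w_i\in M$. A conformal linear map of $M$ to itself is a $\Bbbk$-linear map $a:M\to H^{\otimes2}\otimes_H M$ with $a(hu)=(1\otimes h\otimes_H\mathrm{id})a(u)$ for $h\in H$,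 $u\in M$; the space of these is $\mathrm{Cend}\, M$. For $a,b\in\mathrm{Cend}\, M$ and $u\in M$, write $b(u)=\sum_i h_i\otimes1\otimes_H v_i$ and $a(v_i)=\sum_j h_j\otimes1\otimes_H w_{ij}$, and define $a\vdash b,\ a\dashv b\in\mathrm{Cend}\, M$ by $$(a\vdash b)(u)=\sum_{i,j}\varepsilon(h_j)\,h_i\otimes1\otimes_H w_{ij},\qquad (a\dashv b)(u)=\sum_{i,j}\varepsilon(h_i)\,h_j\otimes1\otimes_H w_{ij}.$$ With these operations $\mathrm{Cend}\, M$ is an associative dialgebra, denoted $\mathrm{Cend}\, M^{(0)}$. The Leibniz algebra $\mathrm{gc}\, M^{(0)}$ is the space $\mathrm{Cend}\, M$ with the operation $[ab]=a\vdash b-b\dashv a$. A conformal representation of a Leibniz algebra $L$ on a left $H$-module $M$ is a homomorphism $\rho:L\to\mathrm{gc}\, M^{(0)}$; it is faithful if it is injective, and finite if $M$ is a finitely generated $H$-module. *)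

theory Defs
  imports
    "HOL-Algebra.Free_Abelian_Groups"
    "HOL-Algebra.Module"
    "HOL-Algebra.Algebraic_Closure_Type"
    "HOL-Computational_Algebra.Polynomial"
begin

locale leibniz_algebra = vector_space scale
  for scale :: "'k::field \<Rightarrow> 'l::ab_group_add \<Rightarrow> 'l" +
  fixes br :: "'l \<Rightarrow> 'l \<Rightarrow> 'l"
  assumes br_add_left: "br (x + y) z = br x z + br y z"
    and br_add_right: "br x (y + z) = br x y + br x z"
    and br_scale_left: "br (scale c x) y = scale c (br x y)"
    and br_scale_right: "br x (scale c y) = scale c (br x y)"
    and leibniz: "br x (br y z) = br (br x y) z + br y (br x z)"

abbreviation H_ring :: "'k::field poly ring"
  where "H_ring \<equiv> ring_of_type_algebra"

text \<open>
  \<open>H \<otimes> H\<close> is the type \<open>'k poly poly\<close>: the outer variable comes from the first tensor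
  factor, the coefficients from the second one.
\<close>

definition tens2 :: "'k::field poly \<Rightarrow> 'k poly \<Rightarrow> 'k poly poly"
  where "tens2 f g = map_poly (\<lambda>c. [:c:]) f * [:g:]"

lemma tens2_monom:
  "tens2 (Polynomial.monom a i) (Polynomial.monom b j)
     = Polynomial.monom (Polynomial.monom (a * b) j) i"
  by (simp add: tens2_def map_poly_monom mult.commute[of _ "[:_:]"] smult_monom
      mult.commute[of b a])

abbreviation T_var :: "'k::field poly"
  where "T_var \<equiv> [:0, 1:]"

definition counit :: "'k::field poly \<Rightarrow> 'k"
  where "counit h = poly h 0"

text \<open>The coproduct is the algebra homomorphism given by substituting \<open>T \<otimes> 1 + 1 \<otimes> T\<close>.\<close>

definition coproduct :: "'k::field poly \<Rightarrow> 'k poly poly"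
  where "coproduct h = poly (map_poly (\<lambda>c. [:[:c:]:]) h) (tens2 T_var 1 + tens2 1 T_var)"

text \<open>
  The right action of \<open>h\<close> on \<open>H \<otimes> H\<close>, \<open>(f \<otimes> g) h = f h\<^sub>(\<^sub>1\<^sub>) \<otimes> g h\<^sub>(\<^sub>2\<^sub>)\<close>, is multiplication by
  \<^term>\<open>coproduct h\<close>. The tensor product is the quotient of the free abelian group on pairs by
  the biadditivity and balancing relations.
\<close>

definition tensor_free ::
    "('k::field poly, 'm, 'c) module_scheme \<Rightarrow> ('k poly poly \<times> 'm \<Rightarrow>\<^sub>0 int) monoid"
  where "tensor_free M = free_Abelian_group (UNIV \<times> carrier M)"

definition tensor_rel ::
    "('k::field poly, 'm, 'c) module_scheme \<Rightarrow> ('k poly poly \<times> 'm \<Rightarrow>\<^sub>0 int) set"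
  where "tensor_rel M = generate (tensor_free M)
    ({frag_of (p + q, u) - frag_of (p, u) - frag_of (q, u) | p q u. u \<in> carrier M} \<union>
     {frag_of (p, u \<oplus>\<^bsub>M\<^esub> v) - frag_of (p, u) - frag_of (p, v) | p u v.
        u \<in> carrier M \<and> v \<in> carrier M} \<union>
     {frag_of (p * coproduct h, u) - frag_of (p, h \<odot>\<^bsub>M\<^esub> u) | p h u. u \<in> carrier M})"

definition pure_tensor ::
    "('k::field poly, 'm, 'c) module_scheme \<Rightarrow> 'k poly poly \<Rightarrow> 'm
       \<Rightarrow> ('k poly poly \<times> 'm \<Rightarrow>\<^sub>0 int) set"
  where "pure_tensor M p u = tensor_rel M #>\<^bsub>tensor_free M\<^esub> frag_of (p, u)"

text \<open>
  The tensor product is a left module over the algebra \<open>H \<otimes> H\<close>; elements of \<open>\<k>\<close> act through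
  the constants of \<open>H \<otimes> H\<close>. The ring components \<open>mult\<close> and \<open>one\<close> of the record carry no meaning.
\<close>

definition tensor_module ::
    "('k::field poly, 'm, 'c) module_scheme
       \<Rightarrow> ('k poly poly, ('k poly poly \<times> 'm \<Rightarrow>\<^sub>0 int) set) module"
  where "tensor_module M =
    \<lparr> carrier = rcosets\<^bsub>tensor_free M\<^esub> (tensor_rel M),
      monoid.mult = undefined,
      one = undefined,
      zero = tensor_rel M,
      add = (\<lambda>x y. x <#>\<^bsub>tensor_free M\<^esub> y),
      module.smult = (\<lambda>p x. \<Union>c\<in>x. tensor_rel M #>\<^bsub>tensor_free M\<^esub>
                 frag_extend (\<lambda>(q, u). frag_of (p * q, u)) c) \<rparr>"

text \<open>
  The coefficients of an element in its unique expansion \<open>\<Sum>\<^sub>i h\<^sub>i \<otimes> 1 \<otimes>\<^sub>H w\<^sub>i\<close> with respect to the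
  basis \<open>h\<^sub>i = T\<^sup>i\<close> of \<open>H\<close>. The products defined below do not depend on the choice of basis.
\<close>

abbreviation basis_H :: "nat \<Rightarrow> 'k::field poly"
  where "basis_H i \<equiv> T_var ^ i"

definition tensor_supp :: "('k::field poly, 'm, 'c) module_scheme \<Rightarrow> (nat \<Rightarrow> 'm) \<Rightarrow> nat set"
  where "tensor_supp M w = {i. w i \<noteq> \<zero>\<^bsub>M\<^esub>}"

definition tensor_coeff ::
    "('k::field poly, 'm, 'c) module_scheme \<Rightarrow> ('k poly poly \<times> 'm \<Rightarrow>\<^sub>0 int) set \<Rightarrow> nat \<Rightarrow> 'm"
  where "tensor_coeff M x = (THE w. w \<in> UNIV \<rightarrow> carrier M \<and> finite (tensor_supp M w) \<and>
    x = (\<Oplus>\<^bsub>tensor_module M\<^esub>i\<in>tensor_supp M w. pure_tensor M (tens2 (basis_H i) 1) (w i)))"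

definition Cend ::
    "('k::field poly, 'm, 'c) module_scheme \<Rightarrow> ('m \<Rightarrow> ('k poly poly \<times> 'm \<Rightarrow>\<^sub>0 int) set) set"
  where "Cend M = {a \<in> carrier M \<rightarrow>\<^sub>E carrier (tensor_module M).
    (\<forall>u\<in>carrier M. \<forall>v\<in>carrier M. a (u \<oplus>\<^bsub>M\<^esub> v) = a u \<oplus>\<^bsub>tensor_module M\<^esub> a v) \<and>
    (\<forall>c. \<forall>u\<in>carrier M. a ([:c:] \<odot>\<^bsub>M\<^esub> u) = [:[:c:]:] \<odot>\<^bsub>tensor_module M\<^esub> a u) \<and>
    (\<forall>h. \<forall>u\<in>carrier M. a (h \<odot>\<^bsub>M\<^esub> u) = tens2 1 h \<odot>\<^bsub>tensor_module M\<^esub> a u)}"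

definition cend_add ::
    "('k::field poly, 'm, 'c) module_scheme
       \<Rightarrow> ('m \<Rightarrow> ('k poly poly \<times> 'm \<Rightarrow>\<^sub>0 int) set) \<Rightarrow> ('m \<Rightarrow> ('k poly poly \<times> 'm \<Rightarrow>\<^sub>0 int) set)
       \<Rightarrow> ('m \<Rightarrow> ('k poly poly \<times> 'm \<Rightarrow>\<^sub>0 int) set)"
  where "cend_add M a b = (\<lambda>u\<in>carrier M. a u \<oplus>\<^bsub>tensor_module M\<^esub> b u)"

definition cend_minus ::
    "('k::field poly, 'm, 'c) module_scheme
       \<Rightarrow> ('m \<Rightarrow> ('k poly poly \<times> 'm \<Rightarrow>\<^sub>0 int) set) \<Rightarrow> ('m \<Rightarrow> ('k poly poly \<times> 'm \<Rightarrow>\<^sub>0 int) set)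
       \<Rightarrow> ('m \<Rightarrow> ('k poly poly \<times> 'm \<Rightarrow>\<^sub>0 int) set)"
  where "cend_minus M a b = (\<lambda>u\<in>carrier M. a u \<ominus>\<^bsub>tensor_module M\<^esub> b u)"

definition cend_scale ::
    "('k::field poly, 'm, 'c) module_scheme \<Rightarrow> 'k
       \<Rightarrow> ('m \<Rightarrow> ('k poly poly \<times> 'm \<Rightarrow>\<^sub>0 int) set) \<Rightarrow> ('m \<Rightarrow> ('k poly poly \<times> 'm \<Rightarrow>\<^sub>0 int) set)"
  where "cend_scale M c a = (\<lambda>u\<in>carrier M. [:[:c:]:] \<odot>\<^bsub>tensor_module M\<^esub> a u)"

text \<open>
  With \<open>b(u) = \<Sum>\<^sub>i h\<^sub>i \<otimes> 1 \<otimes>\<^sub>H v\<^sub>i\<close> and \<open>a(v\<^sub>i) = \<Sum>\<^sub>j h\<^sub>j \<otimes> 1 \<otimes>\<^sub>H w\<^sub>i\<^sub>j\<close>, the two dialgebra products are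
  \<open>\<Sum>\<^sub>i\<^sub>j \<epsilon>(h\<^sub>j) h\<^sub>i \<otimes> 1 \<otimes>\<^sub>H w\<^sub>i\<^sub>j\<close> and \<open>\<Sum>\<^sub>i\<^sub>j \<epsilon>(h\<^sub>i) h\<^sub>j \<otimes> 1 \<otimes>\<^sub>H w\<^sub>i\<^sub>j\<close>.
\<close>

definition cend_vdash ::
    "('k::field poly, 'm, 'c) module_scheme
       \<Rightarrow> ('m \<Rightarrow> ('k poly poly \<times> 'm \<Rightarrow>\<^sub>0 int) set) \<Rightarrow> ('m \<Rightarrow> ('k poly poly \<times> 'm \<Rightarrow>\<^sub>0 int) set)
       \<Rightarrow> ('m \<Rightarrow> ('k poly poly \<times> 'm \<Rightarrow>\<^sub>0 int) set)"
  where "cend_vdash M a b = (\<lambda>u\<in>carrier M.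
    let v = tensor_coeff M (b u); w = (\<lambda>i. tensor_coeff M (a (v i))) in
    (\<Oplus>\<^bsub>tensor_module M\<^esub>i\<in>tensor_supp M v. \<Oplus>\<^bsub>tensor_module M\<^esub>j\<in>tensor_supp M (w i).
       pure_tensor M (tens2 (Polynomial.smult (counit (basis_H j)) (basis_H i)) 1) (w i j)))"

definition cend_dashv ::
    "('k::field poly, 'm, 'c) module_scheme
       \<Rightarrow> ('m \<Rightarrow> ('k poly poly \<times> 'm \<Rightarrow>\<^sub>0 int) set) \<Rightarrow> ('m \<Rightarrow> ('k poly poly \<times> 'm \<Rightarrow>\<^sub>0 int) set)
       \<Rightarrow> ('m \<Rightarrow> ('k poly poly \<times> 'm \<Rightarrow>\<^sub>0 int) set)"
  where "cend_dashv M a b = (\<lambda>u\<in>carrier M.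
    let v = tensor_coeff M (b u); w = (\<lambda>i. tensor_coeff M (a (v i))) in
    (\<Oplus>\<^bsub>tensor_module M\<^esub>i\<in>tensor_supp M v. \<Oplus>\<^bsub>tensor_module M\<^esub>j\<in>tensor_supp M (w i).
       pure_tensor M (tens2 (Polynomial.smult (counit (basis_H i)) (basis_H j)) 1) (w i j)))"

definition gc_bracket ::
    "('k::field poly, 'm, 'c) module_scheme
       \<Rightarrow> ('m \<Rightarrow> ('k poly poly \<times> 'm \<Rightarrow>\<^sub>0 int) set) \<Rightarrow> ('m \<Rightarrow> ('k poly poly \<times> 'm \<Rightarrow>\<^sub>0 int) set)
       \<Rightarrow> ('m \<Rightarrow> ('k poly poly \<times> 'm \<Rightarrow>\<^sub>0 int) set)"
  where "gc_bracket M a b = cend_minus M (cend_vdash M a b) (cend_dashv M b a)"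

definition conformal_representation ::
    "('k::field \<Rightarrow> 'l::ab_group_add \<Rightarrow> 'l) \<Rightarrow> ('l \<Rightarrow> 'l \<Rightarrow> 'l)
       \<Rightarrow> ('k poly, 'm, 'c) module_scheme
       \<Rightarrow> ('l \<Rightarrow> 'm \<Rightarrow> ('k poly poly \<times> 'm \<Rightarrow>\<^sub>0 int) set) \<Rightarrow> bool"
  where "conformal_representation scale br M \<rho> \<longleftrightarrow>
    Module.module H_ring M \<and>
    range \<rho> \<subseteq> Cend M \<and>
    (\<forall>x y. \<rho> (x + y) = cend_add M (\<rho> x) (\<rho> y)) \<and>
    (\<forall>c x. \<rho> (scale c x) = cend_scale M c (\<rho> x)) \<and>
    (\<forall>x y. \<rho> (br x y) = gc_bracket M (\<rho> x) (\<rho> y))"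

definition faithful_conformal_representation ::
    "('k::field \<Rightarrow> 'l::ab_group_add \<Rightarrow> 'l) \<Rightarrow> ('l \<Rightarrow> 'l \<Rightarrow> 'l)
       \<Rightarrow> ('k poly, 'm, 'c) module_scheme
       \<Rightarrow> ('l \<Rightarrow> 'm \<Rightarrow> ('k poly poly \<times> 'm \<Rightarrow>\<^sub>0 int) set) \<Rightarrow> bool"
  where "faithful_conformal_representation scale br M \<rho> \<longleftrightarrow>
    conformal_representation scale br M \<rho> \<and> inj \<rho>"

definition finitely_generated_module :: "('r, 'm, 'c) module_scheme \<Rightarrow> 'r ring \<Rightarrow> bool"
  where "finitely_generated_module M R \<longleftrightarrow>
    (\<exists>S. finite S \<and> S \<subseteq> carrier M \<and>
      (\<forall>u\<in>carrier M. \<exists>f\<in>S \<rightarrow> carrier R. u = (\<Oplus>\<^bsub>M\<^esub>s\<in>S. f s \<odot>\<^bsub>M\<^esub> s)))"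

definition finite_dim :: "('k::field \<Rightarrow> 'l::ab_group_add \<Rightarrow> 'l) \<Rightarrow> bool"
  where "finite_dim scale \<longleftrightarrow> (\<exists>B. finite_dimensional_vector_space scale B)"

end

theory Submission
  imports Defs "HOL-Library.Product_Plus"
begin

text \<open>
  Let \<open>M\<close> be an \<open>H\<close>-module, and write \<open>x\<close> for the element \<open>T \<otimes> 1\<close> of \<open>H \<otimes> H\<close>. Since \<open>1 \<otimes> T = \<Delta>(T) - T \<otimes> 1\<close>,
  the space \<open>(H \<otimes> H) \<otimes>\<^sub>H M\<close> is the space \<open>M[x]\<close> of polynomials in \<open>x\<close> with coefficients in \<open>M\<close>, on
  which \<open>1 \<otimes> T\<close> acts as \<open>T - x\<close>. So a conformal endomorphism is a linear map \<open>u \<mapsto> a\<^sub>x(u)\<close> from \<open>M\<close> to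
  \<open>M[x]\<close> with \<open>a\<^sub>x(T u) = (T - x) a\<^sub>x(u)\<close>. In these terms the two dialgebra products substitute \<open>x = 0\<close> in
  one of the factors: \<open>(a \<turnstile> b)\<^sub>x = a\<^sub>0 b\<^sub>x\<close> and \<open>(a \<stileturn> b)\<^sub>x = a\<^sub>x b\<^sub>0\<close>, hence \<open>[a b]\<^sub>x = a\<^sub>0 b\<^sub>x - b\<^sub>x a\<^sub>0\<close>, the
  commutator of \<open>b\<^sub>x\<close> with the constant term of \<open>a\<close>.

  For a Leibniz algebra \<open>L\<close>, let \<open>V = L \<times> \<k>\<close> and \<open>M = V[T]\<close>. A polynomial \<open>A + x B\<close> over \<open>End V\<close>
  defines a conformal endomorphism of \<open>M\<close> that sends \<open>u(T)\<close> to \<open>(A + x B) u(T - x)\<close>. The representation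
  attaches to \<open>a\<close> in \<open>L\<close> the operator with \<open>A (v, t) = ([a v], 0)\<close> and \<open>B (v, t) = (t a, 0)\<close>. It respects
  brackets because \<open>[A\<^sub>a, A\<^sub>b] = A\<^bsub>[a b]\<^esub>\<close>, which is the Leibniz identity, and
  \<open>[A\<^sub>a, B\<^sub>b] = B\<^bsub>[a b]\<^esub>\<close>, where \<open>B\<^sub>b A\<^sub>a = 0\<close> because \<open>A\<^sub>a\<close> takes values in \<open>L \<times> 0\<close>, on which \<open>B\<^sub>b\<close> vanishes.
  The operators \<open>A\<^sub>a\<close> alone may have a kernel: an element \<open>a\<close> with \<open>[a v] = 0\<close> for all \<open>v\<close> is lost. But the
  bracket uses only the constant term of its left factor, so the coefficient of \<open>x\<close> is free to store
  \<open>a\<close> itself, and \<open>B\<^sub>a (0, 1) = (a, 0)\<close> makes the representation faithful. A finite spanning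
  set of \<open>V\<close> generates \<open>M\<close> over \<open>H\<close>.

  The uniqueness of the expansion in powers of \<open>x\<close>, proved as \<open>expand_inject\<close>, is what turns the
  abstract tensor product into \<open>M[x]\<close>. It rests on the substitution \<open>1 \<otimes> T \<mapsto> T - x\<close>, formalised as
  \<open>straighten\<close>. The lemmas \<open>of_coeffs_in_Cend\<close> and \<open>gc_bracket_of_coeffs\<close> then express \<open>Cend M\<close> and its
  bracket through coefficients, and \<open>gc_bracket_linear_coeffs\<close> is the bracket of the operators \<open>A + x B\<close>.
\<close>

section \<open>The change of variable on \<open>H \<otimes> H\<close>\<close>

lemma const_split: "[:[:a + b:]:] = [:[:a:]:] + [:[:b:]:]"
  by simp

text \<open>
  As a right \<open>H\<close>-module, \<open>H \<otimes> H\<close> is \<open>H[x]\<close>, with \<open>T \<otimes> 1\<close> as \<open>x\<close>. Here \<open>H[x]\<close> is again the type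
  \<open>'k poly poly\<close>, but its coefficients now are the scalars of the right action. The second tensor factor is
  rewritten by \<open>1 \<otimes> T \<mapsto> T - x\<close>; this is the image of \<open>1 \<otimes> g\<close>.
\<close>

definition straighten_coeff :: "'k::field poly \<Rightarrow> 'k poly poly"
  where "straighten_coeff g = poly (map_poly (\<lambda>c. [:[:c:]:]) g) [:T_var, -1:]"

definition straighten :: "'k::field poly poly \<Rightarrow> 'k poly poly"
  where "straighten p = poly (map_poly straighten_coeff p) [:0, 1:]"

lemma straighten_coeff_0 [simp]: "straighten_coeff 0 = 0"
  by (simp add: straighten_coeff_def)

lemma straighten_coeff_pCons [simp]:
  "straighten_coeff (pCons c g) = [:[:c:]:] + [:T_var, -1:] * straighten_coeff g"
  by (simp add: straighten_coeff_def map_poly_pCons)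

lemma straighten_coeff_add: "straighten_coeff (f + g) = straighten_coeff f + straighten_coeff g"
proof (induction f g rule: poly_induct2)
  case (pCons a f b g)
  then show ?case
    unfolding add_pCons straighten_coeff_pCons by (simp only: const_split algebra_simps)
qed simp

lemma straighten_coeff_smult: "straighten_coeff (Polynomial.smult c g) = [:[:c:]:] * straighten_coeff g"
  by (induction g) (simp_all add: algebra_simps)

lemma straighten_0 [simp]: "straighten 0 = 0"
  by (simp add: straighten_def)

lemma straighten_pCons [simp]:
  "straighten (pCons g p) = straighten_coeff g + pCons 0 (straighten p)"
  by (simp add: straighten_def map_poly_pCons)

lemma straighten_add: "straighten (p + q) = straighten p + straighten q"
  by (induction p q rule: poly_induct2) (simp_all add: straighten_coeff_add)

lemma straighten_smult_T:
  "straighten (Polynomial.smult T_var p) = [:T_var, -1:] * straighten p"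
  by (induction p) (simp_all add: algebra_simps smult_add_right)

lemma straighten_smult_const:
  "straighten (Polynomial.smult [:c:] p) = Polynomial.smult [:c:] (straighten p)"
  by (induction p) (simp_all add: straighten_coeff_smult smult_add_right)

lemma tens2_T_1: "tens2 T_var 1 = [:0, 1:]" and tens2_1: "tens2 1 h = [:h:]"
  by (simp_all add: tens2_def map_poly_pCons)

lemma coproduct_0 [simp]: "coproduct 0 = 0"
  by (simp add: coproduct_def)

lemma coproduct_pCons [simp]: "coproduct (pCons c h) = [:[:c:]:] + [:T_var, 1:] * coproduct h"
  by (simp add: coproduct_def map_poly_pCons tens2_T_1 tens2_1)

text \<open>
  The right action of \<open>h\<close> becomes multiplication by a scalar, because \<open>T \<otimes> 1 + 1 \<otimes> T\<close> is sent to
  \<open>x + (T - x) = T\<close>. This makes the coordinates below compatible with the balancing relation.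
\<close>

lemma straighten_mult_coproduct:
  "straighten (p * coproduct h) = Polynomial.smult h (straighten p)"
proof (induction h arbitrary: p)
  case (pCons c h)
  have "straighten (p * [:T_var, 1:]) = Polynomial.smult T_var (straighten p)" for p :: "'a poly poly"
    by (simp add: straighten_add straighten_smult_T)
  moreover have "p * coproduct (pCons c h) = Polynomial.smult [:c:] p + (p * coproduct h) * [:T_var, 1:]"
    by (simp add: algebra_simps)
  ultimately show ?case
    by (simp only: straighten_add straighten_smult_const pCons.IH flip: smult_add_left)
      (simp flip: smult_add_left)
qed simp

lemma T_power: "T_var ^ i = Polynomial.monom 1 i"
  by (simp add: monom_altdef)

lemma tens2_basis_H: "tens2 (basis_H i) 1 = Polynomial.monom 1 i"
  unfolding T_power by (simp add: tens2_def map_poly_monom flip: one_pCons)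

lemma straighten_monom: "straighten (Polynomial.monom 1 i) = Polynomial.monom 1 i"
  by (induction i) (simp_all add: monom_0 monom_Suc one_pCons)

section \<open>The tensor product as a left module over \<open>H \<otimes> H\<close>\<close>

lemma hom_finsum:
  assumes "abelian_group G" "abelian_group G'" "f \<in> hom (add_monoid G) (add_monoid G')"
    and "a \<in> A \<rightarrow> carrier G"
  shows "f (finsum G a A) = finsum G' (\<lambda>i. f (a i)) A"
proof -
  interpret G: abelian_group G by fact
  interpret G': abelian_group G' by fact
  interpret f: abelian_group_hom G G' f
    using assms by (intro abelian_group_homI group_hom.intro) (auto simp: group_hom_axioms_def G.a_group G'.a_group)
  show ?thesis
    using assms(4)
  proof (induction A rule: infinite_finite_induct)
    case (insert x A)
    then have "finsum G a (insert x A) = a x \<oplus>\<^bsub>G\<^esub> finsum G a A"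
      "finsum G' (\<lambda>i. f (a i)) (insert x A) = f (a x) \<oplus>\<^bsub>G'\<^esub> finsum G' (\<lambda>i. f (a i)) A"
      by (auto intro!: G.finsum_insert G'.finsum_insert f.hom_closed)
    with insert show ?case
      by (simp add: f.hom_add G.finsum_closed)
  qed (simp_all add: G.finsum_infinite G'.finsum_infinite)
qed

locale conformal_module = Module.module H_ring M for M :: "('k::field poly, 'm, 'c) module_scheme" (structure)
begin

lemma H_ring_simps [simp]:
  "carrier (H_ring :: 'k poly ring) = UNIV"
  "x \<otimes>\<^bsub>H_ring\<^esub> y = x * y" "x \<oplus>\<^bsub>H_ring\<^esub> y = x + y"
  "\<zero>\<^bsub>H_ring\<^esub> = (0 :: 'k poly)" "\<one>\<^bsub>H_ring\<^esub> = (1 :: 'k poly)"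
  by (simp_all add: ring_of_type_algebra_def)

lemma H_smult [simp]:
  "u \<in> carrier M \<Longrightarrow> (1 :: 'k poly) \<odot> u = u"
  "u \<in> carrier M \<Longrightarrow> (0 :: 'k poly) \<odot> u = \<zero>"
  "(p :: 'k poly) \<odot> \<zero> = \<zero>"
  using smult_one smult_l_null smult_r_null by simp_all

lemma H_smult_add: "u \<in> carrier M \<Longrightarrow> (p + q :: 'k poly) \<odot> u = p \<odot> u \<oplus> q \<odot> u"
  and H_smult_mult: "u \<in> carrier M \<Longrightarrow> (p * q :: 'k poly) \<odot> u = p \<odot> (q \<odot> u)"
  using smult_l_distr[of p q u] smult_assoc1[of p q u] by simp_all

abbreviation "F \<equiv> tensor_free M"
abbreviation "K \<equiv> tensor_rel M"
abbreviation "TM \<equiv> tensor_module M"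

lemma tensor_free_simps [simp]:
  "x \<in> carrier F \<longleftrightarrow> Poly_Mapping.keys x \<subseteq> UNIV \<times> carrier M"
  "x \<otimes>\<^bsub>F\<^esub> y = x + y" "\<one>\<^bsub>F\<^esub> = 0"
  by (simp_all add: tensor_free_def)

lemma inv_tensor_free [simp]: "x \<in> carrier F \<Longrightarrow> inv\<^bsub>F\<^esub> x = - x"
  by (simp add: tensor_free_def)

lemma comm_group_F: "comm_group F"
  by (simp add: tensor_free_def abelian_free_Abelian_group)

sublocale F: comm_group F
  by (rule comm_group_F)

definition rel_gens :: "('k poly poly \<times> 'm \<Rightarrow>\<^sub>0 int) set"
  where "rel_gens = {frag_of (p + q, u) - frag_of (p, u) - frag_of (q, u) | p q u. u \<in> carrier M} \<union>
     {frag_of (p, u \<oplus>\<^bsub>M\<^esub> v) - frag_of (p, u) - frag_of (p, v) | p u v.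
        u \<in> carrier M \<and> v \<in> carrier M} \<union>
     {frag_of (p * coproduct h, u) - frag_of (p, h \<odot>\<^bsub>M\<^esub> u) | p h u. u \<in> carrier M}"

lemma tensor_rel_eq: "K = generate F rel_gens"
  by (simp add: tensor_rel_def rel_gens_def)

lemma keys_diff_subset: "Poly_Mapping.keys a \<subseteq> S \<Longrightarrow> Poly_Mapping.keys b \<subseteq> S \<Longrightarrow> Poly_Mapping.keys (a - b) \<subseteq> S"
  for a b :: "'x \<Rightarrow>\<^sub>0 int"
  using keys_diff by fast

lemma rel_gens_subset: "rel_gens \<subseteq> carrier F"
  unfolding rel_gens_def by (auto simp del: SigmaE intro!: keys_diff_subset dest!: subsetD[OF keys_diff])

lemma normal_K: "K \<lhd> F"
  by (simp add: F.normal_iff_subgroup F.generate_is_subgroup[OF rel_gens_subset] tensor_rel_eq)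

sublocale K: normal K F
  by (rule normal_K)

lemma TM_simps:
  "carrier TM = carrier (F Mod K)" "x \<oplus>\<^bsub>TM\<^esub> y = x \<otimes>\<^bsub>F Mod K\<^esub> y" "\<zero>\<^bsub>TM\<^esub> = \<one>\<^bsub>F Mod K\<^esub>"
  by (simp_all add: tensor_module_def FactGroup_def)

lemma abelian_group_TM: "abelian_group TM"
proof -
  interpret Q: comm_group "F Mod K"
    by (rule F.abelian_FactGroup) (rule K.subgroup_axioms)
  show ?thesis
    by (rule abelian_groupI; unfold TM_simps)
      (rule Q.m_closed Q.one_closed Q.m_assoc Q.m_comm Q.l_one Q.l_inv_ex; assumption)+
qed

sublocale TM: abelian_group TM
  by (rule abelian_group_TM)

abbreviation coset :: "('k poly poly \<times> 'm \<Rightarrow>\<^sub>0 int) \<Rightarrow> ('k poly poly \<times> 'm \<Rightarrow>\<^sub>0 int) set"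
  where "coset c \<equiv> K #>\<^bsub>F\<^esub> c"

lemma carrier_TM: "carrier TM = coset ` carrier F"
  by (auto simp: tensor_module_def RCOSETS_def)

lemma coset_in_TM [simp]: "c \<in> carrier F \<Longrightarrow> coset c \<in> carrier TM"
  unfolding carrier_TM by blast

lemma coset_add: "c \<in> carrier F \<Longrightarrow> d \<in> carrier F \<Longrightarrow> coset c \<oplus>\<^bsub>TM\<^esub> coset d = coset (c + d)"
  using K.rcos_sum[of c d] by (simp add: tensor_module_def)

lemma coset_eqI:
  assumes "c \<in> carrier F" "d \<in> carrier F" "c - d \<in> K"
  shows "coset c = coset d"
proof -
  have "c \<in> coset d"
    using assms by (auto simp: r_coset_def intro!: bexI[of _ "c - d"])
  then show ?thesis
    using F.repr_independence[OF _ _ K.subgroup_axioms] assms by blast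
qed

lemma pure_closed [simp]: "u \<in> carrier M \<Longrightarrow> pure_tensor M p u \<in> carrier TM"
  by (simp add: pure_tensor_def)

lemma rel_gens_in_K: "g \<in> rel_gens \<Longrightarrow> g \<in> K"
  by (simp add: tensor_rel_eq generate.incl)

lemma keys_add_subset: "Poly_Mapping.keys a \<subseteq> S \<Longrightarrow> Poly_Mapping.keys b \<subseteq> S \<Longrightarrow> Poly_Mapping.keys (a + b) \<subseteq> S"
  for a b :: "'x \<Rightarrow>\<^sub>0 int"
  using keys_add by fast

lemma pure_add_left:
  assumes "u \<in> carrier M"
  shows "pure_tensor M (p + q) u = pure_tensor M p u \<oplus>\<^bsub>TM\<^esub> pure_tensor M q u"
proof -
  have "frag_of (p + q, u) - (frag_of (p, u) + frag_of (q, u)) \<in> K"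
    using assms by (intro rel_gens_in_K) (auto simp: rel_gens_def diff_diff_eq)
  then show ?thesis
    using assms by (simp add: pure_tensor_def coset_add coset_eqI keys_add_subset)
qed

lemma pure_add_right:
  assumes "u \<in> carrier M" "v \<in> carrier M"
  shows "pure_tensor M p (u \<oplus> v) = pure_tensor M p u \<oplus>\<^bsub>TM\<^esub> pure_tensor M p v"
proof -
  have "frag_of (p, u \<oplus> v) - (frag_of (p, u) + frag_of (p, v)) \<in> K"
    using assms by (intro rel_gens_in_K) (auto simp: rel_gens_def diff_diff_eq)
  then show ?thesis
    using assms by (simp add: pure_tensor_def coset_add coset_eqI keys_add_subset)
qed

lemma pure_balanced:
  assumes "u \<in> carrier M"
  shows "pure_tensor M (p * coproduct h) u = pure_tensor M p (h \<odot> u)"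
proof -
  have "frag_of (p * coproduct h, u) - frag_of (p, h \<odot> u) \<in> K"
    using assms by (intro rel_gens_in_K) (auto simp: rel_gens_def)
  then show ?thesis
    using assms by (simp add: pure_tensor_def coset_eqI)
qed

definition left_mult :: "'k poly poly \<Rightarrow> ('k poly poly \<times> 'm \<Rightarrow>\<^sub>0 int) \<Rightarrow> ('k poly poly \<times> 'm \<Rightarrow>\<^sub>0 int)"
  where "left_mult p = frag_extend (\<lambda>(q, u). frag_of (p * q, u))"

lemma left_mult_simps [simp]:
  "left_mult p (frag_of (q, u)) = frag_of (p * q, u)"
  "left_mult p (c - d) = left_mult p c - left_mult p d"
  "left_mult p (c + d) = left_mult p c + left_mult p d"
  "left_mult p 0 = 0" "left_mult p (- c) = - left_mult p c"
  by (simp_all add: left_mult_def frag_extend_diff frag_extend_add frag_extend_minus)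

lemma left_mult_closed [simp]:
  assumes "c \<in> carrier F" shows "left_mult p c \<in> carrier F"
  using assms[unfolded tensor_free_simps]
proof (induction c rule: frag_induction)
  case (diff a b) then show ?case by (simp add: keys_diff_subset)
qed auto

text \<open>
  Left multiplication commutes with the right action of \<open>H\<close>, so it maps each generating relation to a
  generating relation and descends to the tensor product.
\<close>

lemma left_mult_K: "c \<in> K \<Longrightarrow> left_mult p c \<in> K"
  unfolding tensor_rel_eq
proof (induction c rule: generate.induct)
  case one
  then show ?case using generate.one[of F rel_gens] by simp
next
  case (incl g)
  have "left_mult p g \<in> rel_gens"
    using incl unfolding rel_gens_def
    by (elim UnE CollectE exE conjE; simp add: distrib_left flip: mult.assoc) blast+
  then show ?case by (rule generate.incl)
next
  case (inv g)
  have "left_mult p g \<in> rel_gens"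
    using inv unfolding rel_gens_def
    by (elim UnE CollectE exE conjE; simp add: distrib_left flip: mult.assoc) blast+
  moreover have "inv\<^bsub>F\<^esub> g = - g" "inv\<^bsub>F\<^esub> (left_mult p g) = - left_mult p g"
    using inv calculation rel_gens_subset by (auto simp del: tensor_free_simps)
  ultimately show ?case using generate.inv[of "left_mult p g" rel_gens F] by simp
next
  case (eng g h)
  then show ?case using generate.eng[of _ F rel_gens] by simp
qed

lemma smult_coset:
  assumes "c \<in> carrier F"
  shows "p \<odot>\<^bsub>TM\<^esub> coset c = coset (left_mult p c)"
proof -
  have "coset (left_mult p d) = coset (left_mult p c)" if "d \<in> coset c" for d
  proof -
    from that obtain k where "k \<in> K" "d = k + c" by (auto simp: r_coset_def)
    then show ?thesis
      using assms left_mult_closed left_mult_K[of k p] K.mem_carrier[of k]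
      by (intro coset_eqI) (simp_all add: keys_add_subset)
  qed
  moreover have "c \<in> coset c" using assms F.rcos_self K.subgroup_axioms by blast
  moreover have "p \<odot>\<^bsub>TM\<^esub> coset c = (\<Union>d\<in>coset c. coset (left_mult p d))"
    by (simp add: tensor_module_def left_mult_def)
  ultimately show ?thesis
    by blast
qed

lemma smult_closed_TM [simp]: "x \<in> carrier TM \<Longrightarrow> p \<odot>\<^bsub>TM\<^esub> x \<in> carrier TM"
  by (auto simp: carrier_TM smult_coset simp del: tensor_free_simps)

lemma smult_add_right_TM:
  "x \<in> carrier TM \<Longrightarrow> y \<in> carrier TM \<Longrightarrow> p \<odot>\<^bsub>TM\<^esub> (x \<oplus>\<^bsub>TM\<^esub> y) = p \<odot>\<^bsub>TM\<^esub> x \<oplus>\<^bsub>TM\<^esub> p \<odot>\<^bsub>TM\<^esub> y"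
proof -
  assume "x \<in> carrier TM" "y \<in> carrier TM"
  then obtain c d where c: "c \<in> carrier F" "d \<in> carrier F" "x = coset c" "y = coset d"
    unfolding carrier_TM by blast
  then have "c + d \<in> carrier F" using F.m_closed by simp
  with c show ?thesis
    by (simp only: smult_coset coset_add left_mult_closed left_mult_simps)
qed

lemma smult_pure: "u \<in> carrier M \<Longrightarrow> p \<odot>\<^bsub>TM\<^esub> pure_tensor M q u = pure_tensor M (p * q) u"
  by (simp add: pure_tensor_def smult_coset)

section \<open>Expansions in powers of \<open>T \<otimes> 1\<close>\<close>

text \<open>
  The coefficient of \<open>x\<^sup>n\<close> is well defined on the tensor product: straightening turns the right action
  of \<open>h\<close> on \<open>p\<close> into a factor \<open>h\<close> of every coefficient, and this factor can be moved to \<open>u\<close>.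
\<close>

lemma coordinate_hom:
  obtains \<chi> where "\<chi> \<in> hom (add_monoid TM) (add_monoid M)"
    "\<And>p u. u \<in> carrier M \<Longrightarrow> \<chi> (pure_tensor M p u) = poly.coeff (straighten p) n \<odot> u"
proof -
  let ?f = "\<lambda>(p, u). poly.coeff (straighten p) n \<odot> u"
  obtain \<phi> where \<phi>: "\<phi> \<in> hom F (add_monoid M)"
    and \<phi>_of: "\<And>x. x \<in> UNIV \<times> carrier M \<Longrightarrow> \<phi> (frag_of x) = ?f x"
    unfolding tensor_free_def
    by (rule comm_group.free_Abelian_group_universal[OF a_comm_group, of ?f "UNIV \<times> carrier M"]) auto
  interpret \<phi>: group_hom F "add_monoid M" \<phi>
    using \<phi> by unfold_locales
  have diff: "\<phi> (c - d) = \<phi> c \<ominus> \<phi> d" if "c \<in> carrier F" "d \<in> carrier F" for c d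
    using \<phi>.hom_mult[of c "- d"] \<phi>.hom_inv[of d] that by (simp add: a_minus_def a_inv_def)
  have cancel: "a \<oplus> b \<oplus> \<ominus> a \<oplus> \<ominus> b = \<zero>" if "a \<in> carrier M" "b \<in> carrier M" for a b
    using that by (metis M.a_comm M.a_assoc M.r_neg2 M.r_neg add.inv_closed add.m_closed)
  have "\<phi> g = \<zero>" if "g \<in> rel_gens" for g
    using that unfolding rel_gens_def
    by (elim UnE CollectE exE conjE)
      (simp_all add: diff \<phi>_of keys_diff_subset straighten_add straighten_mult_coproduct
        H_smult_add smult_r_distr cancel mult.commute M.r_neg a_minus_def flip: H_smult_mult)
  then have "rel_gens \<subseteq> kernel F (add_monoid M) \<phi>"
    using rel_gens_subset by (auto simp: kernel_def simp del: tensor_free_simps(1))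
  then have "K \<subseteq> kernel F (add_monoid M) \<phi>"
    unfolding tensor_rel_eq by (rule F.generate_subgroup_incl) (rule \<phi>.subgroup_kernel)
  then obtain \<chi> where "\<chi> \<in> hom (F Mod K) (add_monoid M)" "\<And>x. x \<in> carrier F \<Longrightarrow> \<chi> (coset x) = \<phi> x"
    using \<phi>.FactGroup_universal_kernel[OF normal_K] by blast
  then show thesis
    using that[of \<chi>] \<phi>_of by (simp add: hom_def TM_simps pure_tensor_def)
qed

definition families :: "(nat \<Rightarrow> 'm) set"
  where "families = {w \<in> UNIV \<rightarrow> carrier M. finite (tensor_supp M w)}"

text \<open>
  The element \<open>\<Sum>\<^sub>i x\<^sup>i w\<^sub>i\<close> of \<open>M[x]\<close>.
\<close>

definition expand :: "(nat \<Rightarrow> 'm) \<Rightarrow> ('k poly poly \<times> 'm \<Rightarrow>\<^sub>0 int) set"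
  where "expand w = (\<Oplus>\<^bsub>TM\<^esub>i\<in>tensor_supp M w. pure_tensor M (Polynomial.monom 1 i) (w i))"

lemma familiesD: "w \<in> families \<Longrightarrow> w i \<in> carrier M" "w \<in> families \<Longrightarrow> finite (tensor_supp M w)"
  by (auto simp: families_def)

lemma familiesI:
  assumes "\<And>i. w i \<in> carrier M" "finite I" "\<And>i. i \<notin> I \<Longrightarrow> w i = \<zero>"
  shows "w \<in> families"
  using assms finite_subset[of "tensor_supp M w" I] by (auto simp: families_def tensor_supp_def)

lemma not_in_tensor_supp: "i \<notin> tensor_supp M w \<Longrightarrow> w i = \<zero>"
  by (simp add: tensor_supp_def)

lemma pure_zero_right [simp]: "pure_tensor M p \<zero> = \<zero>\<^bsub>TM\<^esub>"
  using pure_add_right[of \<zero> \<zero> p] TM.add.l_cancel_one[of "pure_tensor M p \<zero>" "pure_tensor M p \<zero>"] by simp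

lemma expand_eq_finsum:
  assumes "w \<in> families" "finite I" "tensor_supp M w \<subseteq> I"
  shows "expand w = (\<Oplus>\<^bsub>TM\<^esub>i\<in>I. pure_tensor M (Polynomial.monom 1 i) (w i))"
  unfolding expand_def
  by (rule TM.add.finprod_mono_neutral_cong_left) (use assms in \<open>auto simp: familiesD tensor_supp_def\<close>)

lemma expand_closed [simp]: "w \<in> families \<Longrightarrow> expand w \<in> carrier TM"
  unfolding expand_def by (auto intro!: TM.finsum_closed simp: familiesD)

lemma expand_add:
  assumes "v \<in> families" "w \<in> families"
  shows "(\<lambda>i. v i \<oplus> w i) \<in> families" "expand (\<lambda>i. v i \<oplus> w i) = expand v \<oplus>\<^bsub>TM\<^esub> expand w"
proof -
  let ?I = "tensor_supp M v \<union> tensor_supp M w"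
  have I: "finite ?I" "tensor_supp M (\<lambda>i. v i \<oplus> w i) \<subseteq> ?I"
    using familiesD(2)[OF assms(1)] familiesD(2)[OF assms(2)] by simp_all (auto simp: tensor_supp_def)
  show fam: "(\<lambda>i. v i \<oplus> w i) \<in> families"
    by (rule familiesI[OF _ I(1)]) (use assms in \<open>auto simp: familiesD(1) not_in_tensor_supp\<close>)
  show "expand (\<lambda>i. v i \<oplus> w i) = expand v \<oplus>\<^bsub>TM\<^esub> expand w"
    unfolding expand_eq_finsum[OF fam I] expand_eq_finsum[OF assms(1) I(1) Un_upper1]
      expand_eq_finsum[OF assms(2) I(1) Un_upper2]
    using assms by (simp add: pure_add_right familiesD TM.finsum_addf)
qed

lemma coordinate_expand:
  assumes "\<chi> \<in> hom (add_monoid TM) (add_monoid M)"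
    and "\<And>p u. u \<in> carrier M \<Longrightarrow> \<chi> (pure_tensor M p u) = poly.coeff (straighten p) n \<odot> u"
    and w: "w \<in> families"
  shows "\<chi> (expand w) = w n"
proof -
  let ?I = "insert n (tensor_supp M w)"
  have I: "finite ?I" "tensor_supp M w \<subseteq> ?I"
    using w by (auto simp: familiesD)
  have "\<chi> (expand w) = (\<Oplus>i\<in>?I. \<chi> (pure_tensor M (Polynomial.monom 1 i) (w i)))"
    unfolding expand_eq_finsum[OF w I]
    by (rule hom_finsum) (use assms in \<open>auto simp: familiesD M.abelian_group_axioms TM.abelian_group_axioms\<close>)
  also have "\<dots> = (\<Oplus>i\<in>?I. if n = i then w i else \<zero>)"
    by (rule finsum_cong') (use assms in \<open>auto simp: familiesD straighten_monom\<close>)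
  also have "\<dots> = w n"
    by (rule M.finsum_singleton) (use w in \<open>auto simp: familiesD\<close>)
  finally show ?thesis .
qed

lemma expand_inject:
  assumes "v \<in> families" "w \<in> families" "expand v = expand w"
  shows "v = w"
proof
  fix n
  obtain \<chi> where "\<chi> \<in> hom (add_monoid TM) (add_monoid M)"
    "\<And>p u. u \<in> carrier M \<Longrightarrow> \<chi> (pure_tensor M p u) = poly.coeff (straighten p) n \<odot> u"
    using coordinate_hom[where n = n] by blast
  from coordinate_expand[OF this] show "v n = w n"
    using assms by metis
qed

lemma tensor_coeff_expand:
  assumes "w \<in> families"
  shows "tensor_coeff M (expand w) = w"
  unfolding tensor_coeff_def tens2_basis_H expand_def[symmetric]
  by (rule the_equality) (use assms expand_inject in \<open>auto simp: families_def\<close>)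

lemma smult_expand:
  assumes w: "w \<in> families"
  shows "p \<odot>\<^bsub>TM\<^esub> expand w = (\<Oplus>\<^bsub>TM\<^esub>i\<in>tensor_supp M w. pure_tensor M (p * Polynomial.monom 1 i) (w i))"
proof -
  have "p \<odot>\<^bsub>TM\<^esub> expand w = (\<Oplus>\<^bsub>TM\<^esub>i\<in>tensor_supp M w. p \<odot>\<^bsub>TM\<^esub> pure_tensor M (Polynomial.monom 1 i) (w i))"
    unfolding expand_def
    by (rule hom_finsum) (use w in \<open>auto simp: hom_def smult_add_right_TM familiesD TM.abelian_group_axioms\<close>)
  also have "\<dots> = (\<Oplus>\<^bsub>TM\<^esub>i\<in>tensor_supp M w. pure_tensor M (p * Polynomial.monom 1 i) (w i))"
    by (rule TM.finsum_cong') (use w in \<open>auto simp: familiesD smult_pure\<close>)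
  finally show ?thesis .
qed

text \<open>
  On expansions the module laws of the left action reduce to those of single pure tensors.
\<close>

lemma smult_expand_add:
  assumes w: "w \<in> families"
  shows "(p + q) \<odot>\<^bsub>TM\<^esub> expand w = p \<odot>\<^bsub>TM\<^esub> expand w \<oplus>\<^bsub>TM\<^esub> q \<odot>\<^bsub>TM\<^esub> expand w"
  using w by (simp add: smult_expand distrib_right pure_add_left familiesD TM.finsum_addf)

lemma smult_expand_mult:
  assumes w: "w \<in> families"
  shows "(p * q) \<odot>\<^bsub>TM\<^esub> expand w = p \<odot>\<^bsub>TM\<^esub> (q \<odot>\<^bsub>TM\<^esub> expand w)"
proof -
  have "p \<odot>\<^bsub>TM\<^esub> (\<Oplus>\<^bsub>TM\<^esub>i\<in>tensor_supp M w. pure_tensor M (q * Polynomial.monom 1 i) (w i)) =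
     (\<Oplus>\<^bsub>TM\<^esub>i\<in>tensor_supp M w. p \<odot>\<^bsub>TM\<^esub> pure_tensor M (q * Polynomial.monom 1 i) (w i))"
    by (rule hom_finsum) (use w in \<open>auto simp: hom_def smult_add_right_TM familiesD TM.abelian_group_axioms\<close>)
  also have "\<dots> = (\<Oplus>\<^bsub>TM\<^esub>i\<in>tensor_supp M w. pure_tensor M (p * q * Polynomial.monom 1 i) (w i))"
    by (rule TM.finsum_cong') (use w in \<open>auto simp: familiesD smult_pure mult.assoc\<close>)
  finally show ?thesis
    using w by (simp add: smult_expand)
qed

lemma coproduct_expand:
  assumes w: "w \<in> families"
  shows "(\<lambda>i. h \<odot> w i) \<in> families" "coproduct h \<odot>\<^bsub>TM\<^esub> expand w = expand (\<lambda>i. h \<odot> w i)"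
proof -
  have supp: "tensor_supp M (\<lambda>i. h \<odot> w i) \<subseteq> tensor_supp M w"
    by (auto simp: tensor_supp_def)
  show fam: "(\<lambda>i. h \<odot> w i) \<in> families"
    using w supp by (intro familiesI[of _ "tensor_supp M w"]) (auto simp: familiesD(1) familiesD(2)[OF w] tensor_supp_def[of M "\<lambda>i. h \<odot> w i"])
  show "coproduct h \<odot>\<^bsub>TM\<^esub> expand w = expand (\<lambda>i. h \<odot> w i)"
    unfolding smult_expand[OF w] expand_eq_finsum[OF fam familiesD(2)[OF w] supp]
    using w by (intro TM.finsum_cong') (auto simp: familiesD mult.commute simp flip: pure_balanced)
qed

text \<open>
  The coefficients of \<open>x\<close> times the polynomial in \<open>x\<close> that has coefficients \<open>w\<close>.
\<close>

definition shift :: "(nat \<Rightarrow> 'm) \<Rightarrow> nat \<Rightarrow> 'm"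
  where "shift w i = (case i of 0 \<Rightarrow> \<zero> | Suc j \<Rightarrow> w j)"

lemma shift_expand:
  assumes w: "w \<in> families"
  shows "shift w \<in> families" "[:0, 1:] \<odot>\<^bsub>TM\<^esub> expand w = expand (shift w)"
proof -
  have supp: "tensor_supp M (shift w) = Suc ` tensor_supp M w"
    by (auto simp: tensor_supp_def shift_def image_iff gr0_conv_Suc split: nat.splits)
  show "shift w \<in> families"
    by (rule familiesI[OF _ finite_imageI[OF familiesD(2)[OF w]], of _ Suc])
      (use w supp in \<open>auto simp: familiesD(1) shift_def intro: not_in_tensor_supp split: nat.splits\<close>)
  show "[:0, 1:] \<odot>\<^bsub>TM\<^esub> expand w = expand (shift w)"
    unfolding smult_expand[OF w] expand_def[of "shift w"] supp
    by (subst TM.finsum_reindex) (use w in \<open>auto simp: familiesD shift_def monom_Suc\<close>)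
qed

section \<open>Conformal endomorphisms in coefficients\<close>

definition of_coeffs :: "('m \<Rightarrow> nat \<Rightarrow> 'm) \<Rightarrow> 'm \<Rightarrow> ('k poly poly \<times> 'm \<Rightarrow>\<^sub>0 int) set"
  where "of_coeffs \<alpha> = (\<lambda>u\<in>carrier M. expand (\<alpha> u))"

text \<open>
  Here \<open>\<alpha> u n\<close> is the coefficient of \<open>x\<^sup>n\<close> in \<open>a\<^sub>x(u)\<close>. The last clause is \<open>a\<^sub>x(T u) = (T - x) a\<^sub>x(u)\<close>, written
  without subtraction.
\<close>

definition conformal_coeffs :: "('m \<Rightarrow> nat \<Rightarrow> 'm) \<Rightarrow> bool"
  where "conformal_coeffs \<alpha> \<longleftrightarrow>
    (\<forall>u\<in>carrier M. \<alpha> u \<in> families) \<and>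
    (\<forall>u\<in>carrier M. \<forall>v\<in>carrier M. \<forall>n. \<alpha> (u \<oplus> v) n = \<alpha> u n \<oplus> \<alpha> v n) \<and>
    (\<forall>c. \<forall>u\<in>carrier M. \<forall>n. \<alpha> ([:c:] \<odot> u) n = [:c:] \<odot> \<alpha> u n) \<and>
    (\<forall>u\<in>carrier M. \<forall>n. T_var \<odot> \<alpha> u n = \<alpha> (T_var \<odot> u) n \<oplus> shift (\<alpha> u) n)"

text \<open>
  Linearity over \<open>1 \<otimes> H\<close> need only be checked for constants and for \<open>T\<close>, which generate \<open>H\<close>. For \<open>T\<close> the
  action of \<open>1 \<otimes> T\<close> is obtained by subtracting that of \<open>T \<otimes> 1\<close> from that of the coproduct of \<open>T\<close>.
\<close>

lemma of_coeffs_in_Cend: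
  assumes "conformal_coeffs \<alpha>"
  shows "of_coeffs \<alpha> \<in> Cend M"
proof -
  have fam: "\<alpha> u \<in> families" if "u \<in> carrier M" for u
    using assms that by (simp add: conformal_coeffs_def)
  have add: "expand (\<alpha> (u \<oplus> v)) = expand (\<alpha> u) \<oplus>\<^bsub>TM\<^esub> expand (\<alpha> v)"
    if "u \<in> carrier M" "v \<in> carrier M" for u v
  proof -
    have "\<alpha> (u \<oplus> v) = (\<lambda>n. \<alpha> u n \<oplus> \<alpha> v n)"
      using assms that by (auto simp: conformal_coeffs_def)
    then show ?thesis
      using that by (simp add: expand_add fam)
  qed
  have const: "expand (\<alpha> ([:c:] \<odot> u)) = [:[:c:]:] \<odot>\<^bsub>TM\<^esub> expand (\<alpha> u)" if "u \<in> carrier M" for c u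
  proof -
    have "\<alpha> ([:c:] \<odot> u) = (\<lambda>n. [:c:] \<odot> \<alpha> u n)"
      using assms that by (auto simp: conformal_coeffs_def)
    then have "expand (\<alpha> ([:c:] \<odot> u)) = coproduct [:c:] \<odot>\<^bsub>TM\<^esub> expand (\<alpha> u)"
      using that by (simp only: coproduct_expand fam)
    then show ?thesis
      by simp
  qed
  have T: "expand (\<alpha> (T_var \<odot> u)) = [:T_var:] \<odot>\<^bsub>TM\<^esub> expand (\<alpha> u)" if "u \<in> carrier M" for u
  proof -
    let ?x = "expand (\<alpha> u)"
    have "coproduct T_var \<odot>\<^bsub>TM\<^esub> ?x = expand (\<lambda>n. T_var \<odot> \<alpha> u n)"
      using that by (simp only: coproduct_expand fam)
    also have "\<dots> = expand (\<lambda>n. \<alpha> (T_var \<odot> u) n \<oplus> shift (\<alpha> u) n)"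
      using assms that by (simp add: conformal_coeffs_def)
    also have "\<dots> = expand (\<alpha> (T_var \<odot> u)) \<oplus>\<^bsub>TM\<^esub> [:0, 1:] \<odot>\<^bsub>TM\<^esub> ?x"
      using that by (simp add: expand_add fam shift_expand)
    finally have "expand (\<alpha> (T_var \<odot> u)) \<oplus>\<^bsub>TM\<^esub> [:0, 1:] \<odot>\<^bsub>TM\<^esub> ?x = coproduct T_var \<odot>\<^bsub>TM\<^esub> ?x" ..
    also have "coproduct T_var = [:T_var:] + [:0, 1:]"
      by simp
    also have "\<dots> \<odot>\<^bsub>TM\<^esub> ?x = [:T_var:] \<odot>\<^bsub>TM\<^esub> ?x \<oplus>\<^bsub>TM\<^esub> [:0, 1:] \<odot>\<^bsub>TM\<^esub> ?x"
      using that by (simp only: smult_expand_add fam)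
    finally show ?thesis
      using that fam by (subst (asm) TM.add.r_cancel) auto
  qed
  have H: "expand (\<alpha> (h \<odot> u)) = [:h:] \<odot>\<^bsub>TM\<^esub> expand (\<alpha> u)" if "u \<in> carrier M" for h u
  proof (induction h)
    case 0
    show ?case
      using const[OF that, of 0] that by simp
  next
    case (pCons c h)
    have "pCons c h = [:c:] + T_var * h"
      by simp
    then have "pCons c h \<odot> u = [:c:] \<odot> u \<oplus> T_var \<odot> (h \<odot> u)"
      using that smult_l_distr[of "[:c:]" "T_var * h" u] smult_assoc1[of T_var h u] by simp
    then have "expand (\<alpha> (pCons c h \<odot> u)) =
        [:[:c:]:] \<odot>\<^bsub>TM\<^esub> expand (\<alpha> u) \<oplus>\<^bsub>TM\<^esub> [:T_var:] \<odot>\<^bsub>TM\<^esub> expand (\<alpha> (h \<odot> u))"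
      using that by (simp add: add const T)
    also have "\<dots> = ([:[:c:]:] + [:T_var:] * [:h:]) \<odot>\<^bsub>TM\<^esub> expand (\<alpha> u)"
      using that by (simp only: pCons.IH smult_expand_mult smult_expand_add fam)
    finally show ?case
      by simp
  qed
  show ?thesis
    unfolding Cend_def of_coeffs_def tens2_1
    using add const H fam by (auto simp del: smult_pCons)
qed

lemma of_coeffs_inject:
  assumes "conformal_coeffs \<alpha>" "conformal_coeffs \<beta>" "of_coeffs \<alpha> = of_coeffs \<beta>" "u \<in> carrier M"
  shows "\<alpha> u = \<beta> u"
proof (rule expand_inject)
  show "expand (\<alpha> u) = expand (\<beta> u)"
    using fun_cong[OF assms(3), of u] assms(4) by (simp add: of_coeffs_def)
qed (use assms in \<open>auto simp: conformal_coeffs_def\<close>)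

lemma cend_add_of_coeffs:
  assumes "conformal_coeffs \<alpha>" "conformal_coeffs \<beta>"
  shows "cend_add M (of_coeffs \<alpha>) (of_coeffs \<beta>) = of_coeffs (\<lambda>u n. \<alpha> u n \<oplus> \<beta> u n)"
  unfolding cend_add_def of_coeffs_def
  by (rule restrict_ext) (use assms in \<open>simp add: expand_add conformal_coeffs_def\<close>)

lemma cend_scale_of_coeffs:
  assumes "conformal_coeffs \<alpha>"
  shows "cend_scale M c (of_coeffs \<alpha>) = of_coeffs (\<lambda>u n. [:c:] \<odot> \<alpha> u n)"
  unfolding cend_scale_def of_coeffs_def
  by (rule restrict_ext)
    (use assms coproduct_expand(2)[of _ "[:c:]"] in \<open>simp add: conformal_coeffs_def\<close>)

lemma conformal_coeffs_zero: "conformal_coeffs \<alpha> \<Longrightarrow> \<alpha> \<zero> n = \<zero>"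
  unfolding conformal_coeffs_def using smult_l_null smult_r_null
  by (metis M.zero_closed H_ring_simps(1,4) UNIV_I familiesD(1) pCons_0_0)

lemma expand_zero [simp]: "expand (\<lambda>_. \<zero>) = \<zero>\<^bsub>TM\<^esub>"
  by (simp add: expand_def tensor_supp_def)

text \<open>
  The counit kills every positive power of \<open>T\<close>: this is why the products evaluate one factor at \<open>x = 0\<close>.
\<close>

lemma tens2_counit:
  "tens2 (Polynomial.smult (counit (basis_H j)) (basis_H i)) 1 =
     (if j = 0 then Polynomial.monom 1 i else (0 :: 'k poly poly))"
  using tens2_basis_H[of i, where ?'a = 'k] by (cases "j = 0") (simp_all add: counit_def tens2_def power_0_left)

lemma pure_zero_left [simp]: "u \<in> carrier M \<Longrightarrow> pure_tensor M 0 u = \<zero>\<^bsub>TM\<^esub>"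
  using pure_balanced[of u 0 0] by simp

lemma finsum_single:
  assumes "finite I" "\<And>i. i \<in> I \<Longrightarrow> i \<noteq> n \<Longrightarrow> f i = \<zero>\<^bsub>TM\<^esub>" "n \<notin> I \<Longrightarrow> f n = \<zero>\<^bsub>TM\<^esub>" "f n \<in> carrier TM"
  shows "(\<Oplus>\<^bsub>TM\<^esub>i\<in>I. f i) = f n"
proof -
  have "(\<Oplus>\<^bsub>TM\<^esub>i\<in>I. f i) = (\<Oplus>\<^bsub>TM\<^esub>i\<in>insert n I. if n = i then f i else \<zero>\<^bsub>TM\<^esub>)"
    by (rule TM.add.finprod_mono_neutral_cong_left) (use assms in auto)
  also have "\<dots> = f n"
    by (rule TM.add.finprod_singleton) (use assms in \<open>auto, metis TM.zero_closed\<close>)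
  finally show ?thesis .
qed

text \<open>
  Only \<open>j = 0\<close> survives in the inner sum: \<open>(a \<turnstile> b)\<^sub>x = a\<^sub>0 b\<^sub>x\<close>.
\<close>

lemma cend_vdash_of_coeffs:
  assumes \<alpha>: "conformal_coeffs \<alpha>" and \<beta>: "conformal_coeffs \<beta>"
  shows "cend_vdash M (of_coeffs \<alpha>) (of_coeffs \<beta>) = of_coeffs (\<lambda>u n. \<alpha> (\<beta> u n) 0)"
  unfolding cend_vdash_def Let_def of_coeffs_def[of "\<lambda>u n. \<alpha> (\<beta> u n) 0"]
proof (rule restrict_ext)
  fix u assume u: "u \<in> carrier M"
  have v: "\<beta> u \<in> families" and w: "\<And>i. \<alpha> (\<beta> u i) \<in> families"
    using \<alpha> \<beta> u by (simp_all add: conformal_coeffs_def familiesD)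
  have supp: "tensor_supp M (\<lambda>n. \<alpha> (\<beta> u n) 0) \<subseteq> tensor_supp M (\<beta> u)"
    by (auto simp: tensor_supp_def conformal_coeffs_zero[OF \<alpha>])
  then have fam: "(\<lambda>n. \<alpha> (\<beta> u n) 0) \<in> families"
    using familiesD(2)[OF v] familiesD(1)[OF w] finite_subset by (auto simp: families_def)
  have inner: "(\<Oplus>\<^bsub>TM\<^esub>j\<in>tensor_supp M (\<alpha> (\<beta> u i)).
      pure_tensor M (tens2 (Polynomial.smult (counit (basis_H j)) (basis_H i)) 1) (\<alpha> (\<beta> u i) j)) =
      pure_tensor M (Polynomial.monom 1 i) (\<alpha> (\<beta> u i) 0)" for i
    unfolding tens2_counit
    by (subst finsum_single[of _ 0]) (use w[of i] in \<open>simp_all add: familiesD not_in_tensor_supp\<close>)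
  show "(\<Oplus>\<^bsub>TM\<^esub>i\<in>tensor_supp M (tensor_coeff M (of_coeffs \<beta> u)).
       \<Oplus>\<^bsub>TM\<^esub>j\<in>tensor_supp M (tensor_coeff M (of_coeffs \<alpha> (tensor_coeff M (of_coeffs \<beta> u) i))).
       pure_tensor M (tens2 (Polynomial.smult (counit (basis_H j)) (basis_H i)) 1)
         (tensor_coeff M (of_coeffs \<alpha> (tensor_coeff M (of_coeffs \<beta> u) i)) j)) =
     expand (\<lambda>n. \<alpha> (\<beta> u n) 0)"
    using u by (simp add: of_coeffs_def tensor_coeff_expand v w familiesD(1)[OF v] inner
        expand_eq_finsum[OF fam familiesD(2)[OF v] supp])
qed

text \<open>
  Only \<open>i = 0\<close> survives in the outer sum: \<open>(a \<stileturn> b)\<^sub>x = a\<^sub>x b\<^sub>0\<close>.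
\<close>

lemma cend_dashv_of_coeffs:
  assumes \<alpha>: "conformal_coeffs \<alpha>" and \<beta>: "conformal_coeffs \<beta>"
  shows "cend_dashv M (of_coeffs \<alpha>) (of_coeffs \<beta>) = of_coeffs (\<lambda>u n. \<alpha> (\<beta> u 0) n)"
  unfolding cend_dashv_def Let_def of_coeffs_def[of "\<lambda>u n. \<alpha> (\<beta> u 0) n"]
proof (rule restrict_ext)
  fix u assume u: "u \<in> carrier M"
  have v: "\<beta> u \<in> families" and w: "\<And>i. \<alpha> (\<beta> u i) \<in> families"
    using \<alpha> \<beta> u by (simp_all add: conformal_coeffs_def familiesD)
  have \<alpha>0: "\<alpha> \<zero> = (\<lambda>_. \<zero>)"
    using conformal_coeffs_zero[OF \<alpha>] by blast
  have inner: "(\<Oplus>\<^bsub>TM\<^esub>j\<in>tensor_supp M (\<alpha> (\<beta> u i)).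
      pure_tensor M (tens2 (Polynomial.smult (counit (basis_H i)) (basis_H j)) 1) (\<alpha> (\<beta> u i) j)) =
      (if i = 0 then expand (\<alpha> (\<beta> u i)) else \<zero>\<^bsub>TM\<^esub>)" for i
    by (simp add: tens2_counit familiesD[OF w] expand_def)
  show "(\<Oplus>\<^bsub>TM\<^esub>i\<in>tensor_supp M (tensor_coeff M (of_coeffs \<beta> u)).
       \<Oplus>\<^bsub>TM\<^esub>j\<in>tensor_supp M (tensor_coeff M (of_coeffs \<alpha> (tensor_coeff M (of_coeffs \<beta> u) i))).
       pure_tensor M (tens2 (Polynomial.smult (counit (basis_H i)) (basis_H j)) 1)
         (tensor_coeff M (of_coeffs \<alpha> (tensor_coeff M (of_coeffs \<beta> u) i)) j)) =
     expand (\<alpha> (\<beta> u 0))"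
    using u by (simp add: of_coeffs_def tensor_coeff_expand v w familiesD(1)[OF v] inner)
      (subst finsum_single[of _ 0]; use v w[of 0] \<alpha>0 in \<open>simp add: familiesD not_in_tensor_supp\<close>)
qed

text \<open>
  The condition says that \<open>c\<^sub>x = a\<^sub>0 b\<^sub>x - b\<^sub>x a\<^sub>0\<close> for the endomorphism \<open>c\<close> with coefficients \<open>\<gamma>\<close>.
\<close>

lemma gc_bracket_of_coeffs:
  assumes \<alpha>: "conformal_coeffs \<alpha>" and \<beta>: "conformal_coeffs \<beta>" and \<gamma>: "conformal_coeffs \<gamma>"
    and bracket: "\<And>u n. u \<in> carrier M \<Longrightarrow> \<gamma> u n \<oplus> \<beta> (\<alpha> u 0) n = \<alpha> (\<beta> u n) 0"
  shows "gc_bracket M (of_coeffs \<alpha>) (of_coeffs \<beta>) = of_coeffs \<gamma>"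
  unfolding gc_bracket_def cend_vdash_of_coeffs[OF \<alpha> \<beta>] cend_dashv_of_coeffs[OF \<beta> \<alpha>] cend_minus_def
proof (unfold of_coeffs_def, rule restrict_ext)
  fix u assume u: "u \<in> carrier M"
  have fam: "\<gamma> u \<in> families" "\<beta> (\<alpha> u 0) \<in> families"
    using assms u by (auto simp: conformal_coeffs_def familiesD)
  then have "expand (\<lambda>n. \<alpha> (\<beta> u n) 0) = expand (\<gamma> u) \<oplus>\<^bsub>TM\<^esub> expand (\<beta> (\<alpha> u 0))"
    using bracket[OF u] expand_add(2)[OF fam] by simp
  then show "restrict (\<lambda>u. expand (\<lambda>n. \<alpha> (\<beta> u n) 0)) (carrier M) u \<ominus>\<^bsub>TM\<^esub>
      restrict (\<lambda>u. expand (\<lambda>n. \<beta> (\<alpha> u 0) n)) (carrier M) u = expand (\<gamma> u)"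
    using u fam by (simp add: a_minus_def TM.a_assoc TM.r_neg)
qed

end

section \<open>The free module \<open>V[T]\<close>\<close>

locale polynomials_over = vector_space scale
  for scale :: "'k::field \<Rightarrow> 'v::ab_group_add \<Rightarrow> 'v"
begin

definition polys :: "(nat \<Rightarrow> 'v) set"
  where "polys = {u. finite {n. u n \<noteq> 0}}"

definition poly_act :: "'k poly \<Rightarrow> (nat \<Rightarrow> 'v) \<Rightarrow> nat \<Rightarrow> 'v"
  where "poly_act f u n = (\<Sum>i\<le>n. scale (poly.coeff f i) (u (n - i)))"

definition free_module :: "('k poly, nat \<Rightarrow> 'v) module"
  where "free_module =
    \<lparr>carrier = polys, monoid.mult = undefined, one = undefined, zero = (\<lambda>_. 0),
     add = (\<lambda>u v n. u n + v n), module.smult = poly_act\<rparr>"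

lemma free_module_simps [simp]:
  "carrier free_module = polys" "\<zero>\<^bsub>free_module\<^esub> = (\<lambda>_. 0)"
  "u \<oplus>\<^bsub>free_module\<^esub> v = (\<lambda>n. u n + v n)" "f \<odot>\<^bsub>free_module\<^esub> u = poly_act f u"
  by (simp_all add: free_module_def)

lemma polysI:
  assumes "u \<in> polys" "\<And>n. u n = 0 \<Longrightarrow> v n = 0"
  shows "v \<in> polys"
  using assms by (auto simp: polys_def elim!: rev_finite_subset)

lemma polys_zero [simp]: "(\<lambda>_. 0) \<in> polys"
  by (simp add: polys_def)

lemma polys_add:
  assumes "u \<in> polys" "v \<in> polys"
  shows "(\<lambda>n. u n + v n) \<in> polys"
  using assms unfolding polys_def by (auto intro: finite_subset[of _ "{n. u n \<noteq> 0} \<union> {n. v n \<noteq> 0}"])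

lemma polys_eventually_zero: "u \<in> polys \<longleftrightarrow> (\<exists>N. \<forall>n\<ge>N. u n = 0)"
proof
  assume "u \<in> polys"
  then obtain N where "{n. u n \<noteq> 0} \<subseteq> {..<N}"
    unfolding polys_def by (auto dest: finite_nat_bounded)
  then show "\<exists>N. \<forall>n\<ge>N. u n = 0" by (intro exI[of _ N]) (auto simp: subset_iff not_less[symmetric])
next
  assume "\<exists>N. \<forall>n\<ge>N. u n = 0"
  then obtain N where "\<forall>n\<ge>N. u n = 0" ..
  then have "{n. u n \<noteq> 0} \<subseteq> {..<N}"
    by (auto simp flip: not_le)
  then show "u \<in> polys" unfolding polys_def using finite_subset by blast
qed

definition mult_T :: "(nat \<Rightarrow> 'v) \<Rightarrow> nat \<Rightarrow> 'v"
  where "mult_T u n = (case n of 0 \<Rightarrow> 0 | Suc m \<Rightarrow> u m)"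

lemma poly_act_pCons: "poly_act (pCons c f) u = (\<lambda>n. scale c (u n) + mult_T (poly_act f u) n)"
proof
  fix n show "poly_act (pCons c f) u n = scale c (u n) + mult_T (poly_act f u) n"
    by (cases n) (simp_all add: poly_act_def mult_T_def sum.atMost_Suc_shift del: sum.atMost_Suc)
qed

lemma poly_act_0 [simp]: "poly_act 0 u = (\<lambda>_. 0)"
  by (auto simp: poly_act_def)

lemma mult_T_0 [simp]: "mult_T (\<lambda>_. 0) = (\<lambda>_. 0)"
  by (auto simp: mult_T_def split: nat.splits)

lemma mult_T_add: "mult_T (\<lambda>n. u n + v n) = (\<lambda>n. mult_T u n + mult_T v n)"
  by (auto simp: mult_T_def fun_eq_iff split: nat.splits)

lemma poly_act_add_left: "poly_act (f + g) u = (\<lambda>n. poly_act f u n + poly_act g u n)"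
  by (simp add: poly_act_def scale_left_distrib sum.distrib fun_eq_iff)

lemma poly_act_add_right: "poly_act f (\<lambda>n. u n + v n) = (\<lambda>n. poly_act f u n + poly_act f v n)"
  by (simp add: poly_act_def scale_right_distrib sum.distrib fun_eq_iff)

lemma poly_act_smult: "poly_act (Polynomial.smult c f) u = (\<lambda>n. scale c (poly_act f u n))"
  by (simp add: poly_act_def scale_sum_right fun_eq_iff)

lemma poly_act_mult: "poly_act (f * g) u = poly_act f (poly_act g u)"
  by (induction f) (simp_all add: poly_act_pCons poly_act_add_left poly_act_smult)

lemma poly_act_const: "poly_act [:c:] u = (\<lambda>n. scale c (u n))"
  and poly_act_T: "poly_act T_var u = mult_T u"
  by (simp_all add: poly_act_pCons)

lemma mult_T_polys: "u \<in> polys \<Longrightarrow> mult_T u \<in> polys"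
  unfolding polys_eventually_zero mult_T_def
  by (metis (no_types, lifting) Suc_le_D Suc_le_mono nat.case(2))

lemma scale_polys: "u \<in> polys \<Longrightarrow> (\<lambda>n. scale c (u n)) \<in> polys"
  by (erule polysI) simp

lemma poly_act_closed: "u \<in> polys \<Longrightarrow> poly_act f u \<in> polys"
  by (induction f) (simp_all add: poly_act_pCons polys_add scale_polys mult_T_polys)

lemma module_free_module: "Module.module H_ring free_module"
proof (rule moduleI)
  show "cring (H_ring :: 'k poly ring)"
    by (rule cring_from_type_algebra)
  show "abelian_group free_module"
  proof (rule abelian_groupI)
    fix u assume "u \<in> carrier free_module"
    then have "(\<lambda>n. - u n) \<in> polys" by (auto intro: polysI)
    then show "\<exists>v\<in>carrier free_module. v \<oplus>\<^bsub>free_module\<^esub> u = \<zero>\<^bsub>free_module\<^esub>"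
      by (intro bexI[of _ "\<lambda>n. - u n"]) auto
  qed (auto simp: polys_add add_ac)
qed (auto simp: ring_of_type_algebra_def poly_act_closed poly_act_add_left poly_act_add_right
    poly_act_mult poly_act_const one_pCons)

sublocale free: conformal_module free_module
  by (simp add: conformal_module_def module_free_module)

section \<open>Conformal endomorphisms of \<open>V[T]\<close>\<close>

text \<open>
  The coefficient of \<open>x\<^sup>j\<close> in \<open>u(T - x)\<close>; it is \<open>(-1)\<^sup>j\<close> times the \<open>j\<close>-th Hasse derivative of \<open>u\<close>, which is
  defined in every characteristic.
\<close>

definition translate_coeff :: "nat \<Rightarrow> (nat \<Rightarrow> 'v) \<Rightarrow> nat \<Rightarrow> 'v"
  where "translate_coeff j u m = scale ((-1) ^ j * of_nat ((m + j) choose j)) (u (m + j))"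

text \<open>
  Comparing coefficients in \<open>T u(T - x) = (T - x) u(T - x) + x u(T - x)\<close>; in coordinates this is Pascal's rule.
\<close>

lemma translate_coeff_T:
  "mult_T (translate_coeff j u) m =
    translate_coeff j (mult_T u) m + (case j of 0 \<Rightarrow> 0 | Suc i \<Rightarrow> translate_coeff i u m)"
proof (cases j)
  case 0
  then show ?thesis
    by (cases m) (simp_all add: translate_coeff_def mult_T_def)
next
  case (Suc i)
  show ?thesis
  proof (cases m)
    case 0
    then show ?thesis
      using Suc by (simp add: translate_coeff_def mult_T_def flip: scale_left_distrib)
  next
    case m: (Suc k)
    have "(-1) ^ j * of_nat ((k + j) choose j) =
        (-1) ^ j * of_nat ((m + j) choose j) + (-1) ^ i * (of_nat ((m + i) choose i) :: 'k)"
      unfolding m Suc add_Suc binomial_Suc_Suc by (simp add: algebra_simps)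
    then have "scale ((-1) ^ j * of_nat ((k + j) choose j)) (u (k + j)) =
        scale ((-1) ^ j * of_nat ((m + j) choose j)) (u (k + j)) +
        scale ((-1) ^ i * of_nat ((m + i) choose i)) (u (k + j))"
      by (simp only: scale_left_distrib)
    then show ?thesis
      unfolding translate_coeff_def mult_T_def m Suc by simp
  qed
qed

lemma translate_coeff_add: "translate_coeff j (\<lambda>n. u n + v n) m = translate_coeff j u m + translate_coeff j v m"
  and translate_coeff_scale: "translate_coeff j (\<lambda>n. scale c (u n)) m = scale c (translate_coeff j u m)"
  by (simp_all add: translate_coeff_def scale_right_distrib mult.commute)

text \<open>
  The coefficient of \<open>x\<^sup>j\<close> in \<open>(A + x B) u(T - x)\<close>.
\<close>

definition linear_coeffs :: "('v \<Rightarrow> 'v) \<Rightarrow> ('v \<Rightarrow> 'v) \<Rightarrow> (nat \<Rightarrow> 'v) \<Rightarrow> nat \<Rightarrow> nat \<Rightarrow> 'v"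
  where "linear_coeffs A B u j = (\<lambda>m. translate_coeff j (\<lambda>n. A (u n)) m +
    (case j of 0 \<Rightarrow> 0 | Suc i \<Rightarrow> translate_coeff i (\<lambda>n. B (u n)) m))"

abbreviation linear_map :: "('v \<Rightarrow> 'v) \<Rightarrow> bool"
  where "linear_map \<equiv> module_hom scale scale"

lemma linear_map_iff:
  "linear_map A \<longleftrightarrow> (\<forall>u v. A (u + v) = A u + A v) \<and> (\<forall>c v. A (scale c v) = scale c (A v))"
  by (simp add: module_hom_iff module_axioms)

lemma linear_map_0: "linear_map A \<Longrightarrow> A 0 = 0"
  unfolding linear_map_iff by (metis scale_zero_left)

lemma linear_map_mult_T: "linear_map A \<Longrightarrow> (\<lambda>n. A (mult_T u n)) = mult_T (\<lambda>n. A (u n))"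
  by (auto simp: mult_T_def linear_map_0 split: nat.splits)

lemma conformal_linear_coeffs:
  assumes A: "linear_map A" and B: "linear_map B"
  shows "free.conformal_coeffs (linear_coeffs A B)"
  unfolding free.conformal_coeffs_def
proof (intro conjI ballI allI)
  fix u assume "u \<in> carrier free_module"
  then obtain N where N: "\<And>n. n \<ge> N \<Longrightarrow> u n = 0"
    by (auto simp: polys_eventually_zero)
  (* The strict inequality makes room for the factor x of B, which shifts j by one. *)
  have zero: "linear_coeffs A B u j m = 0" if "N < m + j" for j m
    using that by (auto simp: linear_coeffs_def translate_coeff_def N linear_map_0[OF A] linear_map_0[OF B] split: nat.split)
  show "linear_coeffs A B u \<in> free.families"
  proof (rule free.familiesI[of _ "{..N}"])
    show "linear_coeffs A B u j \<in> carrier free_module" for j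
      using zero[of _ j] by (auto simp: polys_eventually_zero intro!: exI[of _ "Suc N"])
    show "linear_coeffs A B u j = \<zero>\<^bsub>free_module\<^esub>" if "j \<notin> {..N}" for j
      using zero[of _ j] that by auto
  qed simp
next
  fix u v j assume "u \<in> carrier free_module" "v \<in> carrier free_module"
  show "linear_coeffs A B (u \<oplus>\<^bsub>free_module\<^esub> v) j = linear_coeffs A B u j \<oplus>\<^bsub>free_module\<^esub> linear_coeffs A B v j"
    using A B by (cases j) (auto simp: linear_coeffs_def linear_map_iff translate_coeff_add)
next
  fix c u j assume "u \<in> carrier free_module"
  show "linear_coeffs A B ([:c:] \<odot>\<^bsub>free_module\<^esub> u) j = [:c:] \<odot>\<^bsub>free_module\<^esub> linear_coeffs A B u j"
    using A B by (cases j)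
      (auto simp: linear_coeffs_def linear_map_iff poly_act_const translate_coeff_scale scale_right_distrib)
next
  fix u j assume u: "u \<in> carrier free_module"
  show "T_var \<odot>\<^bsub>free_module\<^esub> linear_coeffs A B u j =
      linear_coeffs A B (T_var \<odot>\<^bsub>free_module\<^esub> u) j \<oplus>\<^bsub>free_module\<^esub> free.shift (linear_coeffs A B u) j"
    by (cases j)
      (auto simp: poly_act_T free.shift_def linear_coeffs_def mult_T_add translate_coeff_T
        linear_map_mult_T[OF A] linear_map_mult_T[OF B] split: nat.split)
qed

lemma linear_coeffs_add:
  "linear_coeffs (\<lambda>v. A v + A' v) (\<lambda>v. B v + B' v) u j =
     linear_coeffs A B u j \<oplus>\<^bsub>free_module\<^esub> linear_coeffs A' B' u j"
  by (cases j) (auto simp: linear_coeffs_def translate_coeff_add)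

lemma linear_coeffs_scale:
  "linear_coeffs (\<lambda>v. scale c (A v)) (\<lambda>v. scale c (B v)) u j = [:c:] \<odot>\<^bsub>free_module\<^esub> linear_coeffs A B u j"
  by (cases j) (auto simp: linear_coeffs_def translate_coeff_scale poly_act_const scale_right_distrib)

lemma linear_coeffs_0: "linear_coeffs A B u 0 = (\<lambda>n. A (u n))"
  by (simp add: linear_coeffs_def translate_coeff_def)

text \<open>
  A linear map of \<open>V\<close> that acts on coefficients commutes with the substitution \<open>T \<mapsto> T - x\<close>, so brackets
  can be computed in \<open>End V\<close>.
\<close>

lemma linear_coeffs_left:
  assumes "linear_map C"
  shows "(\<lambda>m. C (linear_coeffs A B u j m)) = linear_coeffs (\<lambda>v. C (A v)) (\<lambda>v. C (B v)) u j"
proof -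
  have add: "C (v + w) = C v + C w" for v w
    using assms by (simp add: linear_map_iff)
  have "C (translate_coeff i w m) = translate_coeff i (\<lambda>n. C (w n)) m" for i w m
    using assms by (simp add: translate_coeff_def linear_map_iff)
  then show ?thesis
    by (cases j) (simp_all add: linear_coeffs_def add)
qed

text \<open>
  The bracket of \<open>A + x B\<close> and \<open>A' + x B'\<close> is \<open>[A, A'] + x [A, B']\<close>: the left factor enters
  through its constant term.
\<close>

lemma gc_bracket_linear_coeffs:
  assumes "linear_map A" "linear_map B" "linear_map A'" "linear_map B'" "linear_map A''" "linear_map B''"
    and "\<And>v. A'' v + A' (A v) = A (A' v)" "\<And>v. B'' v + B' (A v) = A (B' v)"
  shows "gc_bracket free_module (free.of_coeffs (linear_coeffs A B)) (free.of_coeffs (linear_coeffs A' B')) =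
    free.of_coeffs (linear_coeffs A'' B'')"
proof (rule free.gc_bracket_of_coeffs)
  fix u j assume "u \<in> carrier free_module"
  have "linear_coeffs A'' B'' u j \<oplus>\<^bsub>free_module\<^esub> linear_coeffs A' B' (\<lambda>n. A (u n)) j =
      linear_coeffs (\<lambda>v. A'' v + A' (A v)) (\<lambda>v. B'' v + B' (A v)) u j"
    unfolding linear_coeffs_add by (simp add: linear_coeffs_def)
  also have "\<dots> = linear_coeffs A B (linear_coeffs A' B' u j) 0"
    using assms by (simp add: linear_coeffs_0 linear_coeffs_left)
  finally show "linear_coeffs A'' B'' u j \<oplus>\<^bsub>free_module\<^esub> linear_coeffs A' B' (linear_coeffs A B u 0) j =
      linear_coeffs A B (linear_coeffs A' B' u j) 0"
    by (simp only: linear_coeffs_0)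
qed (intro conformal_linear_coeffs assms)+

definition const_pol :: "'v \<Rightarrow> nat \<Rightarrow> 'v"
  where "const_pol v n = (if n = 0 then v else 0)"

lemma const_pol_polys [simp]: "const_pol v \<in> polys"
  by (auto simp: polys_eventually_zero const_pol_def intro: exI[of _ 1])

text \<open>
  The coefficient at \<open>x\<close> of the image of a constant polynomial recovers \<open>B\<close>; faithfulness rests on this.
\<close>

lemma linear_coeffs_const_pol:
  assumes "linear_map A" "linear_map B"
  shows "linear_coeffs A B (const_pol v) 1 0 = B v"
  using assms by (simp add: linear_coeffs_def translate_coeff_def const_pol_def linear_map_0)

lemma poly_act_const_pol: "poly_act f (const_pol v) n = scale (poly.coeff f n) v"
proof -
  have "poly_act f (const_pol v) n = (\<Sum>i\<le>n. if i = n then scale (poly.coeff f n) v else 0)"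
    unfolding poly_act_def by (rule sum.cong) (auto simp: const_pol_def)
  then show ?thesis by simp
qed

lemma finsum_free_module:
  assumes "finite S" "f \<in> S \<rightarrow> polys"
  shows "(\<Oplus>\<^bsub>free_module\<^esub>s\<in>S. f s) = (\<lambda>n. \<Sum>s\<in>S. f s n)"
  using assms by (induction S rule: finite_induct) (auto simp: free.finsum_insert)

text \<open>
  A spanning set of \<open>V\<close>, taken as constant polynomials, generates \<open>V[T]\<close>: the coefficients of a
  polynomial are expanded one by one, and each spanning vector collects its scalars into an element of \<open>H\<close>.
\<close>

lemma finitely_generated_free_module:
  assumes B: "finite B" and spanning: "\<And>v. \<exists>r. v = (\<Sum>b\<in>B. scale (r b) b)"
  shows "finitely_generated_module free_module H_ring"
  unfolding finitely_generated_module_def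
proof (intro exI conjI ballI)
  obtain r where r: "\<And>v. v = (\<Sum>b\<in>B. scale (r v b) b)"
    using spanning by metis
  show "finite (const_pol ` B)" "const_pol ` B \<subseteq> carrier free_module"
    using B by auto
  fix u assume "u \<in> carrier free_module"
  then obtain N where N: "\<And>n. n \<ge> N \<Longrightarrow> u n = 0"
    by (auto simp: polys_eventually_zero)
  (* Abs_poly needs finite support, and r may write 0 as a nontrivial combination. *)
  define p where "p b = Abs_poly (\<lambda>n. if u n = 0 then 0 else r (u n) b)" for b
  have p: "poly.coeff (p b) n = (if u n = 0 then 0 else r (u n) b)" for b n
    unfolding p_def by (subst coeff_Abs_poly[of N]) (auto simp: N)
  have inj: "inj_on const_pol B"
    by (rule inj_onI) (metis const_pol_def)
  let ?f = "\<lambda>s. p (s 0)"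
  have "u n = (\<Sum>b\<in>B. scale (poly.coeff (p b) n) b)" for n
    using r[of "u n"] by (cases "u n = 0") (simp_all add: p)
  then have "u = (\<lambda>n. \<Sum>s\<in>const_pol ` B. poly_act (?f s) s n)"
    by (simp add: fun_eq_iff sum.reindex[OF inj] poly_act_const_pol const_pol_def[of _ 0])
  also have "\<dots> = (\<Oplus>\<^bsub>free_module\<^esub>s\<in>const_pol ` B. ?f s \<odot>\<^bsub>free_module\<^esub> s)"
    by (simp, rule finsum_free_module[symmetric]) (use B in \<open>auto intro: poly_act_closed\<close>)
  finally show "\<exists>f\<in>const_pol ` B \<rightarrow> carrier H_ring. u = (\<Oplus>\<^bsub>free_module\<^esub>s\<in>const_pol ` B. f s \<odot>\<^bsub>free_module\<^esub> s)"
    by (intro bexI[of _ ?f]) auto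
qed

end

section \<open>The representation on \<open>(L \<times> \<k>)[T]\<close>\<close>

context leibniz_algebra
begin

definition scale_ext :: "'k \<Rightarrow> 'l \<times> 'k \<Rightarrow> 'l \<times> 'k"
  where "scale_ext c v = (scale c (fst v), c * snd v)"

sublocale ext: polynomials_over scale_ext
  by unfold_locales
    (auto simp: scale_ext_def prod_eq_iff scale_right_distrib scale_left_distrib algebra_simps)

definition ad :: "'l \<Rightarrow> 'l \<times> 'k \<Rightarrow> 'l \<times> 'k"
  where "ad x v = (br x (fst v), 0)"

definition point :: "'l \<Rightarrow> 'l \<times> 'k \<Rightarrow> 'l \<times> 'k"
  where "point x v = (scale (snd v) x, 0)"

lemma linear_ad: "ext.linear_map (ad x)" and linear_point: "ext.linear_map (point x)"
  by (auto simp: ext.linear_map_iff ad_def point_def scale_ext_def br_add_right br_scale_right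
      scale_left_distrib)

definition rep :: "'l \<Rightarrow> (nat \<Rightarrow> 'l \<times> 'k) \<Rightarrow> ('k poly poly \<times> (nat \<Rightarrow> 'l \<times> 'k) \<Rightarrow>\<^sub>0 int) set"
  where "rep x = ext.free.of_coeffs (ext.linear_coeffs (ad x) (point x))"

lemma conformal_rep: "ext.free.conformal_coeffs (ext.linear_coeffs (ad x) (point x))"
  by (intro ext.conformal_linear_coeffs linear_ad linear_point)

lemma faithful_rep: "faithful_conformal_representation scale br ext.free_module rep"
  unfolding faithful_conformal_representation_def conformal_representation_def
proof (intro conjI allI)
  show "Module.module H_ring ext.free_module"
    by (rule ext.module_free_module)
  show "range rep \<subseteq> Cend ext.free_module"
    unfolding rep_def using ext.free.of_coeffs_in_Cend[OF conformal_rep] by blast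
  fix x y :: 'l and c :: 'k
  have "ad (x + y) = (\<lambda>v. ad x v + ad y v)" "point (x + y) = (\<lambda>v. point x v + point y v)"
    by (auto simp: ad_def point_def br_add_left scale_right_distrib)
  then have "ext.linear_coeffs (ad (x + y)) (point (x + y)) u n =
      ext.linear_coeffs (ad x) (point x) u n \<oplus>\<^bsub>ext.free_module\<^esub> ext.linear_coeffs (ad y) (point y) u n" for u n
    by (simp only: ext.linear_coeffs_add)
  then show "rep (x + y) = cend_add ext.free_module (rep x) (rep y)"
    unfolding rep_def ext.free.cend_add_of_coeffs[OF conformal_rep conformal_rep] by presburger
  have "ad (scale c x) = (\<lambda>v. scale_ext c (ad x v))" "point (scale c x) = (\<lambda>v. scale_ext c (point x v))"
    by (auto simp: ad_def point_def br_scale_left scale_ext_def mult.commute)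
  then have "ext.linear_coeffs (ad (scale c x)) (point (scale c x)) u n =
      [:c:] \<odot>\<^bsub>ext.free_module\<^esub> ext.linear_coeffs (ad x) (point x) u n" for u n
    by (simp only: ext.linear_coeffs_scale)
  then show "rep (scale c x) = cend_scale ext.free_module c (rep x)"
    unfolding rep_def ext.free.cend_scale_of_coeffs[OF conformal_rep] by presburger
  have "ad (br x y) v + ad y (ad x v) = ad x (ad y v)" for v
    by (simp add: ad_def leibniz[of x y "fst v"])
  moreover have "point (br x y) v + point y (ad x v) = ad x (point y v)" for v
    by (simp add: ad_def point_def br_scale_right)
  ultimately show "rep (br x y) = gc_bracket ext.free_module (rep x) (rep y)"
    unfolding rep_def by (intro ext.gc_bracket_linear_coeffs[symmetric] linear_ad linear_point)
next
  show "inj rep"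
  proof (rule injI)
    fix x y assume "rep x = rep y"
    then have "ext.linear_coeffs (ad x) (point x) (ext.const_pol (0, 1)) =
        ext.linear_coeffs (ad y) (point y) (ext.const_pol (0, 1))"
      unfolding rep_def by (rule ext.free.of_coeffs_inject[OF conformal_rep conformal_rep]) simp
    then have "point x (0, 1) = point y (0, 1)"
      using ext.linear_coeffs_const_pol[OF linear_ad linear_point] by metis
    then show "x = y"
      by (simp add: point_def)
  qed
qed

lemma finitely_generated_rep_module:
  assumes "finite_dim scale"
  shows "finitely_generated_module ext.free_module H_ring"
proof -
  obtain B where "finite_dimensional_vector_space scale B"
    using assms by (auto simp: finite_dim_def)
  then have B: "finite B" "span B = UNIV"
    by (simp_all add: finite_dimensional_vector_space_def finite_dimensional_vector_space_axioms_def)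
  let ?C = "insert (0, 1) ((\<lambda>b. (b, 0)) ` B)"
  show ?thesis
  proof (rule ext.finitely_generated_free_module)
    show "finite ?C" using B by simp
    fix v :: "'l \<times> 'k"
    obtain r where "fst v = (\<Sum>b\<in>B. scale (r b) b)"
      using B span_finite[OF B(1)] by (metis (no_types, lifting) UNIV_I imageE)
    then have "v = (\<Sum>b\<in>?C. scale_ext (if b = (0, 1) then snd v else r (fst b)) b)"
      using B(1) by (subst sum.insert)
       (auto simp: sum.reindex inj_on_def scale_ext_def prod_eq_iff fst_sum snd_sum)
    then show "\<exists>r. v = (\<Sum>b\<in>?C. scale_ext (r b) b)"
      by (rule exI[of "\<lambda>r. v = (\<Sum>b\<in>?C. scale_ext (r b) b)"])
  qed
qed

end

theorem theorem3:
  fixes scale :: "'k::field \<Rightarrow> 'l::ab_group_add \<Rightarrow> 'l"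
    and br :: "'l \<Rightarrow> 'l \<Rightarrow> 'l"
  assumes "leibniz_algebra scale br"
  shows "(\<exists>(M :: ('k poly, nat \<Rightarrow> 'l \<times> 'k) module) \<rho>.
            faithful_conformal_representation scale br M \<rho>) \<and>
         (finite_dim scale \<longrightarrow>
           (\<exists>(M :: ('k poly, nat \<Rightarrow> 'l \<times> 'k) module) \<rho>.
              faithful_conformal_representation scale br M \<rho> \<and>
              finitely_generated_module M H_ring))"
proof -
  interpret leibniz_algebra scale br
    by fact
  show ?thesis
    using faithful_rep finitely_generated_rep_module by blast
qed

end
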